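(* Let $m,n,s$ be positive integers and define $$GL_*(m\times n\times s,\mathbb{R}):=\left(\{A=I_{m\times n}^s+A_0\mid A_0\in\mathbb{R}^{m\times n\times s},\ A\text{ is invertible}\},\ \ltimes_*\right).$$ Then $GL_*(m\times n\times s,\mathbb{R})$ is a group.
   Context: A cubic matrix $A=(a_{i,j,k})\in\mathbb{R}^{m\times n\times s}$ has frontal slices $A^{(k)}=(a_{i,j,k})_{i,j}\in\mathbb{R}^{m\times n}$, $k\in[1,s]$, and is identified with the $sm\times n$ block-column matrix with blocks $A^{(1)},\dots,A^{(s)}$. Addition and scalar multiplication are entrywise. $\Gamma(A)=\mathrm{bcirc}(A)\in\mathbb{R}^{sm\times sn}$ is the block circulant matrix whose $(a,b)$ block ($a,b\in[1,s]$) is $A^{(c)}$ with $c\in[1,s]$, $c\equiv a-b+1 \pmod s$. DK-STP of matrices: for $M\in\mathbb{R}^{m\times n}$, $N\in\mathbb{R}^{p\times q}$ and $t=\mathrm{lcm}(n,p)$, $M\ltimes_{DK} N:=(M\otimes \mathbf{1}_{t/n}^T)(N\otimes\mathbf{1}_{t/p})\in\mathbb{R}^{m\times q}$, where $\mathbf{1}_k$ is the all-ones column vector of length $k$. t-STP: for $A,B\in\mathbb{R}^{m\times n\times s}$, $A\ltimes_* B:=\Gamma(A)\ltimes_{DK}B\in\mathbb{R}^{m\times n\times s}$, where $B$ is taken as its $sm\times n$ block column. Extended ring: $I_{m\times n}^s$ is a formally adjoined identity for $\ltimes_*$ (formally the block column $(I_{m\times n},0,\dots,0)$, where $I_{m\times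 n}$ is a formal identity for $\ltimes_{DK}$ on $\mathbb{R}^{m\times n}$), and $\overline{\mathbb{R}}^{m\times n\times s}:=\{\alpha I_{m\times n}^s+A_0\mid\alpha\in\mathbb{R},\ A_0\in\mathbb{R}^{m\times n\times s}\}$ (formal sums), with product $$(\alpha I_{m\times n}^s+A_0)\ltimes_*(\beta I_{m\times n}^s+B_0):=\alpha\beta I_{m\times n}^s+\alpha B_0+\beta A_0+A_0\ltimes_*B_0.$$ $A\in\overline{\mathbb{R}}^{m\times n\times s}$ is invertible if there is $B\in\overline{\mathbb{R}}^{m\times n\times s}$ with $A\ltimes_*B=B\ltimes_*A=I_{m\times n}^s$. *)

theory Defs
  imports "Jordan_Normal_Form.Matrix" "HOL-Algebra.Group"
begin

text \<open>An m \<open>\<times>\<close> n \<open>\<times>\<close> s cubic matrix is the list of its s frontal slices; all indices are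
  0-based, so \<open>A ! k\<close> is the (k + 1)-st frontal slice.\<close>

type_synonym cubic = "real mat list"

definition cubic_carrier :: "nat \<Rightarrow> nat \<Rightarrow> nat \<Rightarrow> cubic set" where
  "cubic_carrier m n s = {A. length A = s \<and> set A \<subseteq> carrier_mat m n}"

definition cubic_zero :: "nat \<Rightarrow> nat \<Rightarrow> nat \<Rightarrow> cubic" where
  "cubic_zero m n s = replicate s (0\<^sub>m m n)"

definition cubic_add :: "cubic \<Rightarrow> cubic \<Rightarrow> cubic" where
  "cubic_add A B = map2 (+) A B"

definition cubic_smult :: "real \<Rightarrow> cubic \<Rightarrow> cubic" where
  "cubic_smult c A = map (\<lambda>M. c \<cdot>\<^sub>m M) A"

definition block_column :: "nat \<Rightarrow> nat \<Rightarrow> nat \<Rightarrow> cubic \<Rightarrow> real mat" where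
  "block_column m n s A = mat (s * m) n (\<lambda>(i, j). (A ! (i div m)) $$ (i mod m, j))"

definition of_block_column :: "nat \<Rightarrow> nat \<Rightarrow> nat \<Rightarrow> real mat \<Rightarrow> cubic" where
  "of_block_column m n s M = map (\<lambda>k. mat m n (\<lambda>(i, j). M $$ (k * m + i, j))) [0..<s]"

text \<open>Block \<open>(a, b)\<close>, counted from 0, is the slice with index \<open>a - b\<close> modulo s; adding s before
  subtracting avoids truncation on natural numbers.\<close>

definition bcirc :: "nat \<Rightarrow> nat \<Rightarrow> nat \<Rightarrow> cubic \<Rightarrow> real mat" where
  "bcirc m n s A = mat (s * m) (s * n)
     (\<lambda>(i, j). (A ! ((i div m + s - j div n) mod s)) $$ (i mod m, j mod n))"

definition kronecker :: "real mat \<Rightarrow> real mat \<Rightarrow> real mat" where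
  "kronecker M N = mat (dim_row M * dim_row N) (dim_col M * dim_col N)
     (\<lambda>(i, j). M $$ (i div dim_row N, j div dim_col N) * N $$ (i mod dim_row N, j mod dim_col N))"

definition ones_col :: "nat \<Rightarrow> real mat" where
  "ones_col k = mat k 1 (\<lambda>_. 1)"

definition dk_stp :: "real mat \<Rightarrow> real mat \<Rightarrow> real mat" where
  "dk_stp M N = (let t = lcm (dim_col M) (dim_row N) in
     kronecker M (transpose_mat (ones_col (t div dim_col M))) *
     kronecker N (ones_col (t div dim_row N)))"

definition t_stp :: "nat \<Rightarrow> nat \<Rightarrow> nat \<Rightarrow> cubic \<Rightarrow> cubic \<Rightarrow> cubic" where
  "t_stp m n s A B = of_block_column m n s (dk_stp (bcirc m n s A) (block_column m n s B))"

text \<open>The pair \<open>(\<alpha>, A\<^sub>0)\<close> stands for the formal sum of \<open>\<alpha>\<close> times the adjoined identity and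
  \<open>A\<^sub>0\<close>. The identity is formal in all cases, also when m = n.\<close>

definition ext_monoid :: "nat \<Rightarrow> nat \<Rightarrow> nat \<Rightarrow> (real \<times> cubic) monoid" where
  "ext_monoid m n s =
     \<lparr>carrier = UNIV \<times> cubic_carrier m n s,
      mult = (\<lambda>(\<alpha>, A\<^sub>0) (\<beta>, B\<^sub>0).
        (\<alpha> * \<beta>, cubic_add (cubic_add (cubic_smult \<alpha> B\<^sub>0) (cubic_smult \<beta> A\<^sub>0)) (t_stp m n s A\<^sub>0 B\<^sub>0))),
      one = (1, cubic_zero m n s)\<rparr>"

definition GL_star :: "nat \<Rightarrow> nat \<Rightarrow> nat \<Rightarrow> (real \<times> cubic) monoid" where
  "GL_star m n s = (ext_monoid m n s)
     \<lparr>carrier := {A. \<exists>A\<^sub>0 \<in> cubic_carrier m n s. A = (1, A\<^sub>0) \<and> A \<in> Units (ext_monoid m n s)}\<rparr>"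

end

theory Submission imports Defs begin

text \<open>Writing a column index of the circulant as \<open>b * L + r\<close> with \<open>L = lcm n m\<close> turns the t-STP into
  the cyclic convolution of slices with respect to the product
  \<open>\<Sum>r<L. M (i, r div (L div n)) * N (r div (L div m), j)\<close>, which is bilinear and has the associative
  form \<open>M \<Psi> N\<close> for a fixed matrix \<open>\<Psi>\<close>. Hence the extended ring is a monoid under
  multiplication. The scalar part is multiplicative, so the units with scalar part 1 form a
  subgroup of the group of units.\<close>

section \<open>Finite sums and index arithmetic\<close>

lemma sum_lessThan_mult:
  fixes f :: "nat \<Rightarrow> 'a::comm_monoid_add"
  shows "(\<Sum>r<s * L. f r) = (\<Sum>b<s. \<Sum>r<L. f (b * L + r))"
proof -
  have "(\<Sum>r<L. f (b * L + r)) = sum f {b * L..<b * L + L}" for b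
    using sum.shift_bounds_nat_ivl[of f 0 "b * L" L]
    by (simp add: atLeast0LessThan add.commute)
  then show ?thesis
    using sum.nat_group[of f L s] by simp
qed

text \<open>Subtracting \<open>b\<close> modulo \<open>s\<close> permutes the residues, with
  addition of \<open>b\<close> as inverse. This is the change of variables in the proof that the
  convolution is associative.\<close>

lemma sum_cyclic_shift:
  fixes f :: "nat \<Rightarrow> 'a::comm_monoid_add"
  assumes "b < s"
  shows "(\<Sum>e<s. f ((e + s - b) mod s)) = (\<Sum>d<s. f d)"
proof (rule sum.reindex_bij_witness[where i = "\<lambda>d. (d + b) mod s" and j = "\<lambda>e. (e + s - b) mod s"])
  fix e assume "e \<in> {..<s}"
  moreover have "((e + s - b) mod s + b) mod s = (e + s) mod s"
    using assms by (simp add: mod_add_left_eq)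
  ultimately show "((e + s - b) mod s + b) mod s = e" by simp
next
  fix d assume d: "d \<in> {..<s}"
  have "((d + b) mod s + s - b) mod s = ((d + b) mod s + (s - b)) mod s"
    using assms by simp
  also have "\<dots> = (d + b + (s - b)) mod s"
    by (simp only: mod_add_left_eq)
  also have "\<dots> = d"
    using assms d by simp
  finally show "((d + b) mod s + s - b) mod s = d" .
qed (use assms in auto)

lemma mult_add_less_mult:
  fixes a b i k :: nat
  assumes "k < a" "i < b"
  shows "k * b + i < a * b"
proof -
  have "k * b + i < Suc k * b"
    using assms(2) by simp
  also have "\<dots> \<le> a * b"
    using assms(1) by (intro mult_le_mono1) simp
  finally show ?thesis .
qed

section \<open>Entries of the DK-STP\<close>

lemma dim_dk_stp [simp]:
  "dim_row (dk_stp M N) = dim_row M" "dim_col (dk_stp M N) = dim_col N"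
  by (simp_all add: dk_stp_def kronecker_def ones_col_def Let_def)

text \<open>The Kronecker product with a row of ones repeats each column of \<open>M\<close>, and
  the one with a column of ones repeats each row of \<open>N\<close>. So position \<open>r\<close>
  of the stretched factor comes from the integer quotient of \<open>r\<close> by the number of
  repetitions.\<close>

lemma index_dk_stp:
  assumes "i < dim_row M" "j < dim_col N" "t = lcm (dim_col M) (dim_row N)"
  shows "dk_stp M N $$ (i, j) =
    (\<Sum>r<t. M $$ (i, r div (t div dim_col M)) * N $$ (r div (t div dim_row N), j))"
proof -
  let ?p = "t div dim_col M" and ?q = "t div dim_row N"
  have t: "t = dim_col M * ?p" "t = dim_row N * ?q"
    using assms(3) by simp_all
  have "dk_stp M N $$ (i, j) =
      (\<Sum>r<t. kronecker M (transpose_mat (ones_col ?p)) $$ (i, r) * kronecker N (ones_col ?q) $$ (r, j))"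
    using assms t
    by (simp add: dk_stp_def Let_def scalar_prod_def kronecker_def ones_col_def atLeast0LessThan)
  also have "\<dots> = (\<Sum>r<t. M $$ (i, r div ?p) * N $$ (r div ?q, j))"
  proof (rule sum.cong[OF refl])
    fix r assume "r \<in> {..<t}"
    then have r: "r < dim_col M * ?p" "r < dim_row N * ?q"
      using t by simp_all
    \<comment> \<open>A summation index exists here, which excludes zero dimensions; in those
      degenerate cases the sum is empty.\<close>
    then have "?p > 0" "?q > 0"
      by (auto intro: Nat.gr0I)
    then show "kronecker M (transpose_mat (ones_col ?p)) $$ (i, r) * kronecker N (ones_col ?q) $$ (r, j)
        = M $$ (i, r div ?p) * N $$ (r div ?q, j)"
      using r assms by (simp add: kronecker_def ones_col_def)
  qed
  finally show ?thesis .
qed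

section \<open>Cubic matrices: closure and entrywise formulas\<close>

lemma nth_cubic_carrier:
  "A \<in> cubic_carrier m n s \<Longrightarrow> k < s \<Longrightarrow> A ! k \<in> carrier_mat m n"
  unfolding cubic_carrier_def by auto

lemma length_cubic_carrier:
  "A \<in> cubic_carrier m n s \<Longrightarrow> length A = s"
  unfolding cubic_carrier_def by simp

lemma cubic_eqI:
  assumes "A \<in> cubic_carrier m n s" "B \<in> cubic_carrier m n s"
    and "\<And>k i j. k < s \<Longrightarrow> i < m \<Longrightarrow> j < n \<Longrightarrow> A ! k $$ (i, j) = B ! k $$ (i, j)"
  shows "A = B"
proof (rule nth_equalityI)
  show "length A = length B"
    using assms(1,2) by (simp add: length_cubic_carrier)
  fix k assume "k < length A"
  then have "k < s"
    using assms(1) by (simp add: length_cubic_carrier)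
  then show "A ! k = B ! k"
    using nth_cubic_carrier[OF assms(1)] nth_cubic_carrier[OF assms(2)] assms(3)
    by (metis carrier_matD eq_matI)
qed

lemma cubic_carrierI:
  assumes "length A = s" "\<And>k. k < s \<Longrightarrow> A ! k \<in> carrier_mat m n"
  shows "A \<in> cubic_carrier m n s"
  using assms unfolding cubic_carrier_def by (auto simp: in_set_conv_nth)

lemma cubic_zero_closed [simp]: "cubic_zero m n s \<in> cubic_carrier m n s"
  by (rule cubic_carrierI) (auto simp: cubic_zero_def)

lemma cubic_add_closed [simp]:
  assumes "A \<in> cubic_carrier m n s" "B \<in> cubic_carrier m n s"
  shows "cubic_add A B \<in> cubic_carrier m n s"
  using assms
  by (intro cubic_carrierI)
    (auto simp: cubic_add_def length_cubic_carrier dest: nth_cubic_carrier intro!: add_carrier_mat)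

lemma cubic_smult_closed [simp]:
  assumes "A \<in> cubic_carrier m n s"
  shows "cubic_smult c A \<in> cubic_carrier m n s"
  using assms by (intro cubic_carrierI) (auto simp: cubic_smult_def length_cubic_carrier dest: nth_cubic_carrier)

lemma t_stp_closed [simp]: "t_stp m n s A B \<in> cubic_carrier m n s"
  by (rule cubic_carrierI) (auto simp: t_stp_def of_block_column_def)

lemma index_cubic_zero:
  assumes "k < s" "i < m" "j < n"
  shows "cubic_zero m n s ! k $$ (i, j) = 0"
  using assms by (simp add: cubic_zero_def)

lemma index_cubic_add:
  assumes "A \<in> cubic_carrier m n s" "B \<in> cubic_carrier m n s" "k < s" "i < m" "j < n"
  shows "cubic_add A B ! k $$ (i, j) = A ! k $$ (i, j) + B ! k $$ (i, j)"
  using assms nth_cubic_carrier[OF assms(1,3)] nth_cubic_carrier[OF assms(2,3)]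
  by (simp add: cubic_add_def length_cubic_carrier)

lemma index_cubic_smult:
  assumes "A \<in> cubic_carrier m n s" "k < s" "i < m" "j < n"
  shows "cubic_smult c A ! k $$ (i, j) = c * A ! k $$ (i, j)"
  using assms nth_cubic_carrier[OF assms(1,2)]
  by (simp add: cubic_smult_def length_cubic_carrier)

section \<open>The t-STP as a cyclic convolution\<close>

text \<open>Each run of \<open>L\<close> consecutive positions covers exactly \<open>n\<close>
  columns of the circulant and \<open>m\<close> rows of the block column, because \<open>L\<close>
  is a multiple of both. Hence run \<open>b\<close> meets a single block on either side: slice
  \<open>k - b\<close> modulo \<open>s\<close> of \<open>A\<close> and slice \<open>b\<close> of
  \<open>B\<close>.\<close>

lemma index_t_stp:
  assumes "k < s" "i < m" "j < n" and L: "L = lcm n m"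
  shows "t_stp m n s A B ! k $$ (i, j) =
    (\<Sum>b<s. \<Sum>r<L. A ! ((k + s - b) mod s) $$ (i, r div (L div n)) * B ! b $$ (r div (L div m), j))"
proof -
  define p q where "p = L div n" and "q = L div m"
  have pq: "L = n * p" "L = m * q"
    by (simp_all add: p_def q_def L)
  have "L > 0"
    using assms by (simp add: L lcm_pos_nat)
  then have pos: "p > 0" "q > 0"
    using pq by (auto intro: Nat.gr0I)
  have row: "k * m + i < s * m"
    using mult_add_less_mult[OF assms(1,2)] .
  have lcm_s: "s * L = lcm (s * n) (s * m)"
    by (simp add: L lcm_mult_left)
  \<comment> \<open>Scaling both dimensions by \<open>s\<close> scales their lcm as well, so the
    numbers of repetitions are those of a single pair of slices.\<close>
  have div_s: "s * L div (s * n) = p" "s * L div (s * m) = q"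
    using assms(1) by (simp_all add: p_def q_def)
  have "t_stp m n s A B ! k $$ (i, j) =
      dk_stp (bcirc m n s A) (block_column m n s B) $$ (k * m + i, j)"
    using assms by (simp add: t_stp_def of_block_column_def)
  also have "\<dots> = (\<Sum>r<s * L. bcirc m n s A $$ (k * m + i, r div p) * block_column m n s B $$ (r div q, j))"
    using row assms(3) lcm_s div_s
    by (subst index_dk_stp[where t = "s * L"]) (simp_all add: bcirc_def block_column_def)
  also have "\<dots> = (\<Sum>b<s. \<Sum>r<L. bcirc m n s A $$ (k * m + i, (b * L + r) div p) *
      block_column m n s B $$ ((b * L + r) div q, j))"
    by (rule sum_lessThan_mult)
  also have "\<dots> = (\<Sum>b<s. \<Sum>r<L. A ! ((k + s - b) mod s) $$ (i, r div p) * B ! b $$ (r div q, j))"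
  proof (intro sum.cong[OF refl])
    fix b r assume "b \<in> {..<s}" "r \<in> {..<L}"
    then have b: "b < s" and r: "r div p < n" "r div q < m"
      using pq by (simp_all add: less_mult_imp_div_less)
    have "b * L = (b * n) * p" "b * L = (b * m) * q"
      using pq by simp_all
    then have "(b * L + r) div p = b * n + r div p" "(b * L + r) div q = b * m + r div q"
      using pos by (metis div_mult_self3 less_numeral_extra(3))+
    moreover have "b * n + r div p < s * n" "b * m + r div q < s * m"
      using mult_add_less_mult b r by blast+
    ultimately show "bcirc m n s A $$ (k * m + i, (b * L + r) div p) *
        block_column m n s B $$ ((b * L + r) div q, j) =
        A ! ((k + s - b) mod s) $$ (i, r div p) * B ! b $$ (r div q, j)"
      using row r assms by (simp add: bcirc_def block_column_def)
  qed
  finally show ?thesis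
    by (simp add: p_def q_def)
qed

text \<open>Both bracketings expand to one fourfold sum, over two block indices and two positions
  inside a block. They differ only in naming the blocks: \<open>b\<close> and \<open>d\<close> on
  the left, \<open>b\<close> and \<open>e = b + d\<close> modulo \<open>s\<close> on the
  right.\<close>

lemma t_stp_assoc:
  "t_stp m n s (t_stp m n s A B) C = t_stp m n s A (t_stp m n s B C)"
proof (rule cubic_eqI[where m = m and n = n and s = s])
  fix k i j assume kij: "k < s" "i < m" "j < n"
  define L where "L = lcm n m"
  define p q where "p = L div n" and "q = L div m"
  have r_less: "r div p < n" "r div q < m" if "r < L" for r
    using that by (simp_all add: p_def q_def L_def less_mult_imp_div_less)
  note entry = index_t_stp[OF _ _ _ L_def, folded p_def q_def]
  \<comment> \<open>The common summand: \<open>u\<close> contracts \<open>A\<close> with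
    \<open>B\<close>, \<open>r\<close> contracts \<open>B\<close> with \<open>C\<close>, and the
    three slice indices add up to \<open>k\<close> modulo \<open>s\<close>.\<close>
  define g where "g b d r u = A ! ((k + s - (b + d) mod s) mod s) $$ (i, u div p) *
    B ! d $$ (u div q, r div p) * C ! b $$ (r div q, j)" for b d r u
  have shift: "((k + s - b) mod s + s - d) mod s = (k + s - (b + d) mod s) mod s"
    if "b < s" "d < s" for b d
  proof -
    \<comment> \<open>Over the integers subtraction does not truncate, and both sides reduce to
      \<open>k - b - d\<close> modulo \<open>s\<close>.\<close>
    have "int (((k + s - b) mod s + s - d) mod s) = int ((k + s - (b + d) mod s) mod s)"
    proof -
      let ?y = "int k + int s - int b"
      have "(b + d) mod s \<le> k + s"
        using that by (simp add: less_imp_le trans_le_add2)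
      then have "int ((k + s - (b + d) mod s) mod s) = (int k + int s - (int b + int d)) mod int s"
        by (simp add: zmod_int of_nat_diff mod_simps)
      moreover have "int (((k + s - b) mod s + s - d) mod s) = (?y mod int s + int s - int d) mod int s"
        using that by (simp add: zmod_int of_nat_diff)
      moreover have "(?y mod int s + int s - int d) mod int s = (?y + int s - int d) mod int s"
        by (metis mod_add_left_eq mod_diff_left_eq)
      moreover have "?y + int s - int d = (int k + int s - (int b + int d)) + int s"
        by simp
      ultimately show ?thesis
        by (metis mod_add_self2)
    qed
    then show ?thesis by (simp only: of_nat_eq_iff)
  qed
  have "t_stp m n s (t_stp m n s A B) C ! k $$ (i, j) =
      (\<Sum>b<s. \<Sum>r<L. \<Sum>d<s. \<Sum>u<L. g b d r u)"
    unfolding entry[OF kij]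
  proof (intro sum.cong[OF refl])
    fix b r assume br: "b \<in> {..<s}" "r \<in> {..<L}"
    then have "(k + s - b) mod s < s" by simp
    then show "t_stp m n s A B ! ((k + s - b) mod s) $$ (i, r div p) * C ! b $$ (r div q, j) =
        (\<Sum>d<s. \<Sum>u<L. g b d r u)"
      using br kij r_less shift
      by (simp add: entry g_def sum_distrib_right)
  qed
  also have "\<dots> = (\<Sum>b<s. \<Sum>d<s. \<Sum>u<L. \<Sum>r<L. g b d r u)"
    by (rule sum.cong[OF refl], subst sum.swap) (rule sum.cong[OF refl sum.swap])
  \<comment> \<open>The new index \<open>e\<close> is the slice of the inner product of
    \<open>B\<close> and \<open>C\<close>, so \<open>d\<close> becomes \<open>e - b\<close> modulo
    \<open>s\<close>.\<close>
  also have "\<dots> = (\<Sum>b<s. \<Sum>e<s. \<Sum>u<L. \<Sum>r<L. g b ((e + s - b) mod s) r u)"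
    by (intro sum.cong refl sum_cyclic_shift[symmetric]) simp
  also have "\<dots> = (\<Sum>e<s. \<Sum>u<L. \<Sum>b<s. \<Sum>r<L. g b ((e + s - b) mod s) r u)"
    by (subst sum.swap) (intro sum.cong refl sum.swap)
  also have "\<dots> = t_stp m n s A (t_stp m n s B C) ! k $$ (i, j)"
    unfolding entry[OF kij]
  proof (intro sum.cong[OF refl])
    fix e u assume eu: "e \<in> {..<s}" "u \<in> {..<L}"
    \<comment> \<open>With this the slice of \<open>A\<close> in \<open>g\<close> depends on
      \<open>e\<close> alone and factors out of the sums over \<open>b\<close> and
      \<open>r\<close>.\<close>
    have "(b + (e + s - b) mod s) mod s = e" if "b < s" for b
    proof -
      have "(b + (e + s - b) mod s) mod s = (b + (e + s - b)) mod s"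
        by (rule mod_add_right_eq)
      then show ?thesis using that eu by simp
    qed
    then show "(\<Sum>b<s. \<Sum>r<L. g b ((e + s - b) mod s) r u) =
        A ! ((k + s - e) mod s) $$ (i, u div p) * t_stp m n s B C ! e $$ (u div q, j)"
      using eu kij r_less
      by (simp add: entry g_def sum_distrib_left mult.assoc)
  qed
  finally show "t_stp m n s (t_stp m n s A B) C ! k $$ (i, j) =
      t_stp m n s A (t_stp m n s B C) ! k $$ (i, j)" .
qed simp_all

text \<open>Each term of the convolution is linear in an entry of either factor. These rules expand
  the mixed terms of the extended product.\<close>

lemma index_t_stp_linear:
  assumes "A \<in> cubic_carrier m n s" "B \<in> cubic_carrier m n s" "C \<in> cubic_carrier m n s"
    and kij: "k < s" "i < m" "j < n"
  shows index_t_stp_add_left: "t_stp m n s (cubic_add A B) C ! k $$ (i, j) =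
      t_stp m n s A C ! k $$ (i, j) + t_stp m n s B C ! k $$ (i, j)"
    and index_t_stp_add_right: "t_stp m n s C (cubic_add A B) ! k $$ (i, j) =
      t_stp m n s C A ! k $$ (i, j) + t_stp m n s C B ! k $$ (i, j)"
    and index_t_stp_smult_left: "t_stp m n s (cubic_smult c A) C ! k $$ (i, j) =
      c * t_stp m n s A C ! k $$ (i, j)"
    and index_t_stp_smult_right: "t_stp m n s C (cubic_smult c A) ! k $$ (i, j) =
      c * t_stp m n s C A ! k $$ (i, j)"
proof -
  \<comment> \<open>The entry formulas for sums and scalar multiples hold only for indices in range,
    so the bounds must be available under the summation signs.\<close>
  have r_less: "r div (lcm n m div n) < n" "r div (lcm n m div m) < m" if "r < lcm n m" for r
    using that by (simp_all add: less_mult_imp_div_less)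
  have "(k + s - b) mod s < s" for b
    using kij by simp
  note simps = index_t_stp[OF kij refl] index_cubic_add[OF assms(1,2)] index_cubic_smult[OF assms(1)]
    r_less kij this
  show "t_stp m n s (cubic_add A B) C ! k $$ (i, j) =
      t_stp m n s A C ! k $$ (i, j) + t_stp m n s B C ! k $$ (i, j)"
    by (simp add: simps sum.distrib[symmetric] distrib_right)
  show "t_stp m n s C (cubic_add A B) ! k $$ (i, j) =
      t_stp m n s C A ! k $$ (i, j) + t_stp m n s C B ! k $$ (i, j)"
    by (simp add: simps sum.distrib[symmetric] distrib_left)
  show "t_stp m n s (cubic_smult c A) C ! k $$ (i, j) = c * t_stp m n s A C ! k $$ (i, j)"
    by (simp add: simps sum_distrib_left mult.assoc)
  show "t_stp m n s C (cubic_smult c A) ! k $$ (i, j) = c * t_stp m n s C A ! k $$ (i, j)"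
    by (simp add: simps sum_distrib_left mult.left_commute)
qed

lemma t_stp_zero:
  shows t_stp_zero_left: "t_stp m n s (cubic_zero m n s) A = cubic_zero m n s"
    and t_stp_zero_right: "t_stp m n s A (cubic_zero m n s) = cubic_zero m n s"
  by (rule cubic_eqI[where m = m and n = n and s = s];
      simp add: index_t_stp[OF _ _ _ refl] index_cubic_zero less_mult_imp_div_less)+

section \<open>The extended monoid and its units with scalar part 1\<close>

text \<open>This is the usual unitization: after expanding a triple product, the mixed terms agree
  by bilinearity and the pure term by \<open>t_stp_assoc\<close>. The adjoined identity is neutral
  because its cubic part is zero.\<close>

lemma monoid_ext_monoid: "monoid (ext_monoid m n s)"
proof (rule monoidI)
  fix x y z
  assume "x \<in> carrier (ext_monoid m n s)" "y \<in> carrier (ext_monoid m n s)"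
    "z \<in> carrier (ext_monoid m n s)"
  then obtain \<alpha> A \<beta> B \<gamma> C where xyz: "x = (\<alpha>, A)" "y = (\<beta>, B)" "z = (\<gamma>, C)"
    and ABC: "A \<in> cubic_carrier m n s" "B \<in> cubic_carrier m n s" "C \<in> cubic_carrier m n s"
    by (auto simp: ext_monoid_def)
  note index = index_cubic_add[where m = m and n = n and s = s]
    index_cubic_smult[where m = m and n = n and s = s] index_t_stp_linear
  show "x \<otimes>\<^bsub>ext_monoid m n s\<^esub> y \<in> carrier (ext_monoid m n s)"
    using ABC by (simp add: ext_monoid_def xyz)
  show "x \<otimes>\<^bsub>ext_monoid m n s\<^esub> y \<otimes>\<^bsub>ext_monoid m n s\<^esub> z =
      x \<otimes>\<^bsub>ext_monoid m n s\<^esub> (y \<otimes>\<^bsub>ext_monoid m n s\<^esub> z)"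
    unfolding xyz ext_monoid_def using ABC
    by (auto intro!: cubic_eqI[where m = m and n = n and s = s]
        simp: index t_stp_assoc algebra_simps)
next
  fix x assume "x \<in> carrier (ext_monoid m n s)"
  then obtain \<alpha> A where x: "x = (\<alpha>, A)" and A: "A \<in> cubic_carrier m n s"
    by (auto simp: ext_monoid_def)
  show "\<one>\<^bsub>ext_monoid m n s\<^esub> \<otimes>\<^bsub>ext_monoid m n s\<^esub> x = x"
    and "x \<otimes>\<^bsub>ext_monoid m n s\<^esub> \<one>\<^bsub>ext_monoid m n s\<^esub> = x"
    unfolding x ext_monoid_def using A
    by (auto intro!: cubic_eqI[where m = m and n = n and s = s]
        simp: t_stp_zero index_cubic_zero index_cubic_add[where m = m and n = n and s = s]
          index_cubic_smult[where m = m and n = n and s = s])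
qed (simp add: ext_monoid_def)

lemma fst_mult_ext_monoid: "fst (x \<otimes>\<^bsub>ext_monoid m n s\<^esub> y) = fst x * fst y"
  by (simp add: ext_monoid_def split: prod.split)

text \<open>Exhibits the carrier as the kernel of the scalar part on the group of units.\<close>

lemma carrier_GL_star:
  "carrier (GL_star m n s) = {x \<in> Units (ext_monoid m n s). fst x = 1}"
  by (auto simp: GL_star_def Units_def ext_monoid_def)

theorem lemma4:
  fixes m n s :: nat
  assumes "m > 0" and "n > 0" and "s > 0"
  shows "group (GL_star m n s)"
proof -
  let ?E = "ext_monoid m n s"
  interpret monoid ?E by (rule monoid_ext_monoid)
  have fst_one: "fst \<one>\<^bsub>?E\<^esub> = 1"
    by (simp add: ext_monoid_def)
  \<comment> \<open>Comparing scalar parts in the equation of the inverse shows that inverses taken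
    in \<open>?E\<close> stay in the kernel; they are the witnesses for
    \<open>groupI\<close>.\<close>
  have fst_inv: "fst (inv\<^bsub>?E\<^esub> x) = 1" if "x \<in> Units ?E" "fst x = 1" for x
    using that fst_mult_ext_monoid[of m n s "inv\<^bsub>?E\<^esub> x" x] fst_one by simp
  have mult: "x \<otimes>\<^bsub>GL_star m n s\<^esub> y = x \<otimes>\<^bsub>?E\<^esub> y" for x y
    by (simp add: GL_star_def)
  have one: "\<one>\<^bsub>GL_star m n s\<^esub> = \<one>\<^bsub>?E\<^esub>"
    by (simp add: GL_star_def)
  show ?thesis
  proof (rule groupI)
    fix x assume "x \<in> carrier (GL_star m n s)"
    then have "x \<in> Units ?E" "fst x = 1"
      by (simp_all add: carrier_GL_star)
    then show "\<exists>y\<in>carrier (GL_star m n s). y \<otimes>\<^bsub>GL_star m n s\<^esub> x = \<one>\<^bsub>GL_star m n s\<^esub>"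
      using fst_inv
      by (intro bexI[of _ "inv\<^bsub>?E\<^esub> x"]) (simp_all add: carrier_GL_star mult one)
  qed (auto simp: carrier_GL_star mult one fst_mult_ext_monoid fst_one m_assoc Units_closed)
qed

end
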